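(* Every right-$G$-monogenic mapping $\Phi:\Omega_\zeta\to\mathbb{H}(\mathbb{C})$ in the domain $\Omega_\zeta$ and every left-$G$-monogenic mapping $\widehat{\Phi}:\Omega_\zeta\to\mathbb{H}(\mathbb{C})$ in the domain $\Omega_\zeta$ are $H$-monogenic mappings in $\Omega_\zeta$.
   Context: $\mathbb{H}(\mathbb{C})$ is the algebra of quaternions over $\mathbb{C}$ with basis $1,I,J,K$ ($I^2=J^2=K^2=-1$, $IJ=-JI=K$, $JK=-KJ=I$, $KI=-IK=J$). With $i$ the imaginary complex unit, another basis is $e_1=\frac12(1+iI)$, $e_2=\frac12(1-iI)$, $e_3=\frac12(iJ-K)$, $e_4=\frac12(iJ+K)$, with nonzero products $e_1e_1=e_1$, $e_1e_3=e_3$, $e_2e_2=e_2$, $e_2e_4=e_4$, $e_3e_2=e_3$, $e_3e_4=e_1$, $e_4e_1=e_4$, $e_4e_3=e_2$ (all other products of basis elements are $0$) and $1=e_1+e_2$. As a topological vector space $\mathbb{H}(\mathbb{C})\cong\mathbb{C}^4$. Fix $a_1,a_2,b_1,b_2\in\mathbb{C}$ such that $i_1=1$, $i_2=a_1e_1+a_2e_2$, $i_3=b_1e_1+b_2e_2$ are linearly independent over $\mathbb{R}$. Let $E_3=\{\zeta=xi_1+yi_2+zi_3: x,y,z\in\mathbb{R}\}$. $\Omega$ is a domain in $\mathbb{R}^3$ and $\Omega_\zeta=\{xi_1+yi_2+zi_3:(x,y,z)\in\Omega\}\subset E_3$. $G$-monogenic: a continuous mapping $\Phi:\Omega_\zeta\to\mathbb{H}(\mathbb{C})$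 is right-$G$-monogenic in $\Omega_\zeta$ if for every $\zeta\in\Omega_\zeta$ there is $\Phi'(\zeta)\in\mathbb{H}(\mathbb{C})$ with $\lim_{\varepsilon\to0+0}(\Phi(\zeta+\varepsilon h)-\Phi(\zeta))\varepsilon^{-1}=h\,\Phi'(\zeta)$ for all $h\in E_3$. A continuous mapping $\widehat\Phi:\Omega_\zeta\to\mathbb{H}(\mathbb{C})$ is left-$G$-monogenic in $\Omega_\zeta$ if for every $\zeta\in\Omega_\zeta$ there is $\widehat\Phi'(\zeta)\in\mathbb{H}(\mathbb{C})$ with $\lim_{\varepsilon\to0+0}(\widehat\Phi(\zeta+\varepsilon h)-\widehat\Phi(\zeta))\varepsilon^{-1}=\widehat\Phi'(\zeta)\,h$ for all $h\in E_3$. $H$-monogenic: a continuous mapping $\Phi(\zeta)=\sum_{k=1}^4U_k(x,y,z)e_k$, $U_k:\Omega\to\mathbb{C}$, is $H$-monogenic in $\Omega_\zeta$ if the $U_k$ have first-order partial derivatives in $x,y,z$ at each point and the formal differential $d\Phi:=\sum_{k=1}^4\left(\frac{\partial U_k}{\partial x}dx+\frac{\partial U_k}{\partial y}dy+\frac{\partial U_k}{\partial z}dz\right)e_k$ can be written as $d\Phi=\sum_{s=1}^{16}A_s\,d\zeta\,B_s$ with some $\mathbb{H}(\mathbb{C})$-valued functions $A_s,B_s$ on $\Omega_\zeta$, where $d\zeta=dx+i_2dy+i_3dz$ (equality as linear forms in $dx,dy,dz$). *)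

theory Defs
  imports "HOL-Analysis.Analysis"
begin

section \<open>The algebra of complex quaternions\<close>

text \<open>Coordinates are taken with respect to the basis \<open>1, I, J, K\<close>.\<close>

datatype cquat = CQuat (cq_1: complex) (cq_I: complex) (cq_J: complex) (cq_K: complex)

lemma cquat_eq_iff:
  "p = q \<longleftrightarrow> cq_1 p = cq_1 q \<and> cq_I p = cq_I q \<and> cq_J p = cq_J q \<and> cq_K p = cq_K q"
  by (auto intro: cquat.expand)

instantiation cquat :: ring_1
begin

definition "0 = CQuat 0 0 0 0"
definition "1 = CQuat 1 0 0 0"
definition "- p = CQuat (- cq_1 p) (- cq_I p) (- cq_J p) (- cq_K p)"
definition "p + q = CQuat (cq_1 p + cq_1 q) (cq_I p + cq_I q) (cq_J p + cq_J q) (cq_K p + cq_K q)"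
definition "p - q = CQuat (cq_1 p - cq_1 q) (cq_I p - cq_I q) (cq_J p - cq_J q) (cq_K p - cq_K q)"
definition "p * q = CQuat
  (cq_1 p * cq_1 q - cq_I p * cq_I q - cq_J p * cq_J q - cq_K p * cq_K q)
  (cq_1 p * cq_I q + cq_I p * cq_1 q + cq_J p * cq_K q - cq_K p * cq_J q)
  (cq_1 p * cq_J q - cq_I p * cq_K q + cq_J p * cq_1 q + cq_K p * cq_I q)
  (cq_1 p * cq_K q + cq_I p * cq_J q - cq_J p * cq_I q + cq_K p * cq_1 q)"

instance
  by standard
    (simp_all add: cquat_eq_iff zero_cquat_def one_cquat_def uminus_cquat_def plus_cquat_def
      minus_cquat_def times_cquat_def algebra_simps)

end

text \<open>The norm is that of \<open>\<complex>\<^sup>4\<close>, so that the induced topology is the usual one of \<open>\<complex>\<^sup>4\<close>.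
  It is not submultiplicative.\<close>

instantiation cquat :: real_normed_vector
begin

definition "r *\<^sub>R p = CQuat (r *\<^sub>R cq_1 p) (r *\<^sub>R cq_I p) (r *\<^sub>R cq_J p) (r *\<^sub>R cq_K p)"
definition "norm p = norm (cq_1 p, cq_I p, cq_J p, cq_K p)"
definition "sgn p = inverse (norm p) *\<^sub>R (p :: cquat)"
definition "dist p q = norm (p - q :: cquat)"
definition "uniformity = (INF e\<in>{0 <..}. principal {(p :: cquat, q). dist p q < e})"
definition "open (U :: cquat set) \<longleftrightarrow>
  (\<forall>p\<in>U. eventually (\<lambda>(p', q). p' = p \<longrightarrow> q \<in> U) uniformity)"

instance
proof
  fix p q :: cquat and r s :: real
  show "norm (p + q) \<le> norm p + norm q"
    using norm_triangle_ineq[of "(cq_1 p, cq_I p, cq_J p, cq_K p)" "(cq_1 q, cq_I q, cq_J q, cq_K q)"]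
    by (simp add: norm_cquat_def plus_cquat_def)
  show "norm (r *\<^sub>R p) = \<bar>r\<bar> * norm p"
    using norm_scaleR[of r "(cq_1 p, cq_I p, cq_J p, cq_K p)"]
    unfolding norm_cquat_def scaleR_cquat_def by simp
  show "(norm p = 0) = (p = 0)"
    unfolding norm_cquat_def norm_eq_zero by (simp add: cquat_eq_iff zero_cquat_def zero_prod_def)
qed (simp_all add: cquat_eq_iff plus_cquat_def scaleR_cquat_def algebra_simps
      sgn_cquat_def dist_cquat_def uniformity_cquat_def open_cquat_def)

end

instance cquat :: real_algebra_1
  by standard (simp_all add: cquat_eq_iff times_cquat_def scaleR_cquat_def algebra_simps)

text \<open>Multiplication by a complex scalar \<open>c\<close> is multiplication by the central element
  \<open>of_cpx c\<close>.\<close>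

definition of_cpx :: "complex \<Rightarrow> cquat" where
  "of_cpx c = CQuat c 0 0 0"

definition qI :: cquat where "qI = CQuat 0 1 0 0"
definition qJ :: cquat where "qJ = CQuat 0 0 1 0"
definition qK :: cquat where "qK = CQuat 0 0 0 1"

lemmas cquat_defs = cquat_eq_iff zero_cquat_def one_cquat_def uminus_cquat_def plus_cquat_def
  minus_cquat_def times_cquat_def scaleR_cquat_def of_cpx_def qI_def qJ_def qK_def

lemma cquat_basis_expansion:
  "CQuat a b c d = of_cpx a * 1 + of_cpx b * qI + of_cpx c * qJ + of_cpx d * qK"
  by (simp add: cquat_defs)

lemma of_cpx_central: "of_cpx c * q = q * of_cpx c"
  by (simp add: cquat_defs)

lemma hamilton_relations:
  "qI * qI = -1" "qJ * qJ = -1" "qK * qK = -1"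
  "qI * qJ = qK" "qJ * qI = - qK" "qJ * qK = qI" "qK * qJ = - qI" "qK * qI = qJ" "qI * qK = - qJ"
  by (simp_all add: cquat_defs)

definition e1 :: cquat where "e1 = of_cpx (1/2) * (1 + of_cpx \<i> * qI)"
definition e2 :: cquat where "e2 = of_cpx (1/2) * (1 - of_cpx \<i> * qI)"
definition e3 :: cquat where "e3 = of_cpx (1/2) * (of_cpx \<i> * qJ - qK)"
definition e4 :: cquat where "e4 = of_cpx (1/2) * (of_cpx \<i> * qJ + qK)"

lemma e_multiplication_table:
  "e1 * e1 = e1" "e1 * e2 = 0"  "e1 * e3 = e3" "e1 * e4 = 0"
  "e2 * e1 = 0"  "e2 * e2 = e2" "e2 * e3 = 0"  "e2 * e4 = e4"
  "e3 * e1 = 0"  "e3 * e2 = e3" "e3 * e3 = 0"  "e3 * e4 = e1"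
  "e4 * e1 = e4" "e4 * e2 = 0"  "e4 * e3 = e2" "e4 * e4 = 0"
  and one_eq_e1_e2: "1 = e1 + e2"
  by (simp_all add: cquat_defs e1_def e2_def e3_def e4_def)

definition e_basis :: "nat \<Rightarrow> cquat" where
  "e_basis k = (if k = 1 then e1 else if k = 2 then e2 else if k = 3 then e3 else e4)"

lemma e_basis_unique_coordinates:
  "\<exists>!u. u \<in> {1..4} \<rightarrow>\<^sub>E UNIV \<and> q = (\<Sum>k = 1..4. of_cpx (u k) * e_basis k)"
proof -
  have S: "(\<Sum>k = 1..4. of_cpx (u k) * e_basis k) =
      of_cpx (u 1) * e1 + of_cpx (u 2) * e2 + of_cpx (u 3) * e3 + of_cpx (u 4) * e4"
    for u :: "nat \<Rightarrow> complex"
    by (simp add: e_basis_def eval_nat_numeral)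
  define v where "v = (\<lambda>k\<in>{1..4::nat}. if k = 1 then cq_1 q - \<i> * cq_I q
    else if k = 2 then cq_1 q + \<i> * cq_I q
    else if k = 3 then - \<i> * cq_J q - cq_K q else - \<i> * cq_J q + cq_K q)"
  have coords: "q = of_cpx a * e1 + of_cpx b * e2 + of_cpx c * e3 + of_cpx d * e4 \<longleftrightarrow>
      a = cq_1 q - \<i> * cq_I q \<and> b = cq_1 q + \<i> * cq_I q \<and>
      c = - \<i> * cq_J q - cq_K q \<and> d = - \<i> * cq_J q + cq_K q" for a b c d
    by (simp add: cquat_defs e1_def e2_def e3_def e4_def complex_eq_iff field_simps) linarith
  show ?thesis
  proof (rule ex1I[of _ v])
    show "v \<in> {1..4} \<rightarrow>\<^sub>E UNIV \<and> q = (\<Sum>k = 1..4. of_cpx (v k) * e_basis k)"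
      unfolding S coords by (auto simp: v_def)
  next
    fix u assume u: "u \<in> {1..4} \<rightarrow>\<^sub>E UNIV \<and> q = (\<Sum>k = 1..4. of_cpx (u k) * e_basis k)"
    show "u = v"
    proof
      fix k :: nat
      have "k = 1 \<or> k = 2 \<or> k = 3 \<or> k = 4 \<or> k \<notin> {1..4}" by auto
      then show "u k = v k"
        using u unfolding S coords by (auto simp: v_def PiE_def extensional_def)
    qed
  qed
qed


section \<open>The space \<open>E\<^sub>3\<close> and its domains\<close>

definition zeta :: "cquat \<Rightarrow> cquat \<Rightarrow> real ^ 3 \<Rightarrow> cquat" where
  "zeta i2 i3 p = p $ 1 *\<^sub>R 1 + p $ 2 *\<^sub>R i2 + p $ 3 *\<^sub>R i3"

definition E3 :: "cquat \<Rightarrow> cquat \<Rightarrow> cquat set" where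
  "E3 i2 i3 = range (zeta i2 i3)"

definition Omega_zeta :: "cquat \<Rightarrow> cquat \<Rightarrow> (real ^ 3) set \<Rightarrow> cquat set" where
  "Omega_zeta i2 i3 \<Omega> = zeta i2 i3 ` \<Omega>"


section \<open>G-monogenic mappings\<close>

text \<open>A mapping on \<open>\<Omega>\<^sub>\<zeta>\<close> is represented by a total function whose values outside
  \<open>\<Omega>\<^sub>\<zeta>\<close> are irrelevant: for open \<open>\<Omega>\<close> and linearly independent \<open>1, i2, i3\<close>, the
  point \<open>\<zeta> + \<epsilon> h\<close> lies in \<open>\<Omega>\<^sub>\<zeta>\<close> for all small \<open>\<epsilon> > 0\<close>.\<close>

definition right_G_monogenic ::
  "cquat \<Rightarrow> cquat \<Rightarrow> (real ^ 3) set \<Rightarrow> (cquat \<Rightarrow> cquat) \<Rightarrow> bool" where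
  "right_G_monogenic i2 i3 \<Omega> \<Phi> \<longleftrightarrow>
    continuous_on (Omega_zeta i2 i3 \<Omega>) \<Phi> \<and>
    (\<forall>\<zeta>\<in>Omega_zeta i2 i3 \<Omega>. \<exists>\<Phi>'. \<forall>h\<in>E3 i2 i3.
      ((\<lambda>\<epsilon>. (\<Phi> (\<zeta> + \<epsilon> *\<^sub>R h) - \<Phi> \<zeta>) /\<^sub>R \<epsilon>) \<longlongrightarrow> h * \<Phi>') (at_right 0))"

definition left_G_monogenic ::
  "cquat \<Rightarrow> cquat \<Rightarrow> (real ^ 3) set \<Rightarrow> (cquat \<Rightarrow> cquat) \<Rightarrow> bool" where
  "left_G_monogenic i2 i3 \<Omega> \<Phi> \<longleftrightarrow>
    continuous_on (Omega_zeta i2 i3 \<Omega>) \<Phi> \<and>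
    (\<forall>\<zeta>\<in>Omega_zeta i2 i3 \<Omega>. \<exists>\<Phi>'. \<forall>h\<in>E3 i2 i3.
      ((\<lambda>\<epsilon>. (\<Phi> (\<zeta> + \<epsilon> *\<^sub>R h) - \<Phi> \<zeta>) /\<^sub>R \<epsilon>) \<longlongrightarrow> \<Phi>' * h) (at_right 0))"


section \<open>H-monogenic mappings\<close>

definition partial_differentiable :: "(real ^ 3 \<Rightarrow> complex) \<Rightarrow> 3 \<Rightarrow> real ^ 3 \<Rightarrow> bool" where
  "partial_differentiable f j p \<longleftrightarrow> (\<lambda>t::real. f (p + t *\<^sub>R axis j 1)) differentiable (at 0)"

definition partial_deriv :: "(real ^ 3 \<Rightarrow> complex) \<Rightarrow> 3 \<Rightarrow> real ^ 3 \<Rightarrow> complex" where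
  "partial_deriv f j p = vector_derivative (\<lambda>t::real. f (p + t *\<^sub>R axis j 1)) (at 0)"

text \<open>The formal differential at \<open>p\<close> is the real-linear form in \<open>d = (dx, dy, dz)\<close> built from
  the partial derivatives of the components; no total differentiability is required.
  The form \<open>d\<zeta> = dx + i2 dy + i3 dz\<close> is \<open>zeta i2 i3 d\<close>.\<close>

definition formal_differential ::
  "(nat \<Rightarrow> real ^ 3 \<Rightarrow> complex) \<Rightarrow> real ^ 3 \<Rightarrow> real ^ 3 \<Rightarrow> cquat" where
  "formal_differential U p d =
    (\<Sum>k = 1..4. of_cpx (\<Sum>j\<in>UNIV. partial_deriv (U k) j p * of_real (d $ j)) * e_basis k)"

definition H_monogenic ::
  "cquat \<Rightarrow> cquat \<Rightarrow> (real ^ 3) set \<Rightarrow> (cquat \<Rightarrow> cquat) \<Rightarrow> bool" where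
  "H_monogenic i2 i3 \<Omega> \<Phi> \<longleftrightarrow>
    continuous_on (Omega_zeta i2 i3 \<Omega>) \<Phi> \<and>
    (\<exists>U :: nat \<Rightarrow> real ^ 3 \<Rightarrow> complex.
      (\<forall>p\<in>\<Omega>. \<Phi> (zeta i2 i3 p) = (\<Sum>k = 1..4. of_cpx (U k p) * e_basis k)) \<and>
      (\<forall>k\<in>{1..4}. \<forall>j. \<forall>p\<in>\<Omega>. partial_differentiable (U k) j p) \<and>
      (\<exists>A B :: nat \<Rightarrow> cquat \<Rightarrow> cquat. \<forall>p\<in>\<Omega>. \<forall>d.
        formal_differential U p d =
          (\<Sum>s = 1..16. A s (zeta i2 i3 p) * zeta i2 i3 d * B s (zeta i2 i3 p))))"

end

theory Submission
  imports Defs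
begin

text \<open>
  The limits that define \<open>G\<close>-monogenic mappings are one-sided, whereas partial derivatives are
  two-sided. Since \<open>E\<^sub>3\<close> contains \<open>- h\<close> together with \<open>h\<close>, and the
  prescribed limits \<open>h * \<Phi>'\<close> and \<open>\<Phi>' * h\<close> are odd in \<open>h\<close>, the limit along \<open>- h\<close> supplies the missing
  left half of the limit along \<open>h\<close> (\<open>has_vector_derivative_at_0_of_opposite_rays\<close>).
  Taking for \<open>h\<close> the elements \<open>1, i\<^sub>2, i\<^sub>3\<close> gives the two-sided partial derivatives of
  \<open>p \<mapsto> \<Phi> (\<zeta> p)\<close>, hence those of its coordinates with respect to \<open>e\<^sub>1, \<dots>, e\<^sub>4\<close>.

  The prescribed limits are moreover real-linear in \<open>h\<close>. So the form assembled from the three partial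
  derivatives is the value of the derivative at \<open>d\<zeta> = dx + i\<^sub>2 dy + i\<^sub>3 dz\<close>, that is,
  \<open>d\<Phi> = d\<zeta> * \<Phi>'\<close> or \<open>d\<Phi> = \<Phi>' * d\<zeta>\<close>. Each is a sum of the required shape with a single nonzero
  summand. Both cases are instances of a derivative \<open>h \<mapsto> a * h * b\<close>, which is how they are treated
  in \<open>H_monogenic_of_sandwich_derivative\<close>.
\<close>

lemma has_vector_derivative_at_0_of_opposite_rays:
  fixes f :: "real \<Rightarrow> 'a::real_normed_vector"
  assumes pos: "((\<lambda>\<epsilon>. (f \<epsilon> - f 0) /\<^sub>R \<epsilon>) \<longlongrightarrow> v) (at_right 0)"
    and neg: "((\<lambda>\<epsilon>. (f (- \<epsilon>) - f 0) /\<^sub>R \<epsilon>) \<longlongrightarrow> - v) (at_right 0)"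
  shows "(f has_vector_derivative v) (at 0)"
proof -
  have "((\<lambda>\<epsilon>. - ((f (- \<epsilon>) - f 0) /\<^sub>R \<epsilon>)) \<longlongrightarrow> v) (at_right 0)"
    using tendsto_minus[OF neg] by simp
  then have "((\<lambda>\<epsilon>. (f \<epsilon> - f 0) /\<^sub>R \<epsilon>) \<longlongrightarrow> v) (at_left 0)"
    by (simp add: filterlim_at_left_to_right)
  with pos have lim: "((\<lambda>\<epsilon>. (f \<epsilon> - f 0) /\<^sub>R \<epsilon>) \<longlongrightarrow> v) (at 0)"
    by (simp add: filterlim_split_at)
  have "((\<lambda>\<epsilon>. (f \<epsilon> - f 0) /\<^sub>R \<epsilon> - v) \<longlongrightarrow> 0) (at 0)"
    using tendsto_diff[OF lim tendsto_const[of v]] by simp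
  then have "((\<lambda>\<epsilon>. norm ((f \<epsilon> - f 0) /\<^sub>R \<epsilon> - v)) \<longlongrightarrow> 0) (at 0)"
    by (rule tendsto_norm_zero)
  moreover have "\<forall>\<^sub>F \<epsilon> in at 0. norm ((f \<epsilon> - f 0) /\<^sub>R \<epsilon> - v)
      = norm (f \<epsilon> - f 0 - \<epsilon> *\<^sub>R v) / norm \<epsilon>"
  proof (rule eventually_mono[OF eventually_neq_at_within[of 0]])
    fix \<epsilon> :: real assume "\<epsilon> \<noteq> 0"
    then have "(f \<epsilon> - f 0) /\<^sub>R \<epsilon> - v = (f \<epsilon> - f 0 - \<epsilon> *\<^sub>R v) /\<^sub>R \<epsilon>"
      by (simp add: algebra_simps)
    then show "norm ((f \<epsilon> - f 0) /\<^sub>R \<epsilon> - v) = norm (f \<epsilon> - f 0 - \<epsilon> *\<^sub>R v) / norm \<epsilon>"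
      by (simp add: divide_inverse_commute)
  qed
  ultimately have "((\<lambda>\<epsilon>. norm (f \<epsilon> - f 0 - \<epsilon> *\<^sub>R v) / norm \<epsilon>) \<longlongrightarrow> 0) (at 0)"
    by (rule Lim_transform_eventually)
  then show ?thesis
    by (simp add: has_vector_derivative_def has_derivative_at bounded_linear_scaleR_left)
qed

lemma linear_zeta: "linear (zeta i2 i3)"
  by (rule linearI) (simp_all add: zeta_def algebra_simps)

lemma bounded_linear_cquat_components:
  "bounded_linear cq_1" "bounded_linear cq_I" "bounded_linear cq_J" "bounded_linear cq_K"
proof -
  have le: "norm (cq_1 p) \<le> norm p" "norm (cq_I p) \<le> norm p"
    "norm (cq_J p) \<le> norm p" "norm (cq_K p) \<le> norm p" for p
  proof -
    have 1: "norm (cq_J p, cq_K p) \<le> norm (cq_I p, cq_J p, cq_K p)"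
      "norm (cq_I p, cq_J p, cq_K p) \<le> norm p"
      unfolding norm_cquat_def by (rule norm_snd_le)+
    show "norm (cq_1 p) \<le> norm p"
      unfolding norm_cquat_def by (rule norm_fst_le)
    show "norm (cq_I p) \<le> norm p"
      using norm_fst_le[of "cq_I p" "(cq_J p, cq_K p)"] 1 by linarith
    show "norm (cq_J p) \<le> norm p" "norm (cq_K p) \<le> norm p"
      using norm_fst_le[of "cq_J p" "cq_K p"] norm_snd_le[of "cq_K p" "cq_J p"] 1 by linarith+
  qed
  show "bounded_linear cq_1" "bounded_linear cq_I" "bounded_linear cq_J" "bounded_linear cq_K"
    by (rule bounded_linear_intro[where K = 1];
        simp add: le plus_cquat_def scaleR_cquat_def)+
qed

definition e_coord :: "nat \<Rightarrow> cquat \<Rightarrow> complex" where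
  "e_coord k q = (if k = 1 then cq_1 q - \<i> * cq_I q
    else if k = 2 then cq_1 q + \<i> * cq_I q
    else if k = 3 then - \<i> * cq_J q - cq_K q else - \<i> * cq_J q + cq_K q)"

lemma e_coord_expansion: "(\<Sum>k = 1..4. of_cpx (e_coord k q) * e_basis k) = q"
  by (simp add: e_basis_def e_coord_def eval_nat_numeral)
    (simp add: cquat_defs e1_def e2_def e3_def e4_def complex_eq_iff field_simps)

lemma bounded_linear_e_coord: "bounded_linear (e_coord k)"
  unfolding e_coord_def
  by (cases "k = 1"; cases "k = 2"; cases "k = 3")
    (simp_all add: bounded_linear_cquat_components bounded_linear_add bounded_linear_sub
      bounded_linear_minus bounded_linear_const_mult)

text \<open>The factors \<open>a\<close> and \<open>b\<close> may depend on the point. Having both of them covers right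
  differentiability (\<open>a = 1\<close>) and left differentiability (\<open>b = 1\<close>) at once.\<close>

lemma H_monogenic_of_sandwich_derivative:
  assumes cont: "continuous_on (Omega_zeta i2 i3 \<Omega>) \<Phi>"
    and lim: "\<And>\<zeta> h. \<zeta> \<in> Omega_zeta i2 i3 \<Omega> \<Longrightarrow> h \<in> E3 i2 i3 \<Longrightarrow>
      ((\<lambda>\<epsilon>. (\<Phi> (\<zeta> + \<epsilon> *\<^sub>R h) - \<Phi> \<zeta>) /\<^sub>R \<epsilon>) \<longlongrightarrow> a \<zeta> * h * b \<zeta>) (at_right 0)"
  shows "H_monogenic i2 i3 \<Omega> \<Phi>"
proof -
  let ?z = "zeta i2 i3"
  interpret z: linear ?z by (rule linear_zeta)
  define U where "U k p = e_coord k (\<Phi> (?z p))" for k p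
  define D where "D p d = a (?z p) * ?z d * b (?z p)" for p d

  have \<Phi>_deriv: "((\<lambda>t. \<Phi> (?z (p + t *\<^sub>R d))) has_vector_derivative D p d) (at 0)"
    if p: "p \<in> \<Omega>" for p d
  proof (rule has_vector_derivative_at_0_of_opposite_rays)
    have zp: "?z p \<in> Omega_zeta i2 i3 \<Omega>"
      using p by (simp add: Omega_zeta_def)
    have E3: "?z d \<in> E3 i2 i3" "?z (- d) \<in> E3 i2 i3"
      unfolding E3_def by (rule rangeI)+
    show "((\<lambda>\<epsilon>. (\<Phi> (?z (p + \<epsilon> *\<^sub>R d)) - \<Phi> (?z (p + 0 *\<^sub>R d))) /\<^sub>R \<epsilon>) \<longlongrightarrow> D p d) (at_right 0)"
      using lim[OF zp E3(1)] by (simp add: D_def z.add z.scale)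
    show "((\<lambda>\<epsilon>. (\<Phi> (?z (p + (- \<epsilon>) *\<^sub>R d)) - \<Phi> (?z (p + 0 *\<^sub>R d))) /\<^sub>R \<epsilon>) \<longlongrightarrow> - D p d) (at_right 0)"
      using lim[OF zp E3(2)] by (simp add: D_def z.add z.diff z.scale z.neg)
  qed
  have U_deriv: "((\<lambda>t. U k (p + t *\<^sub>R d)) has_vector_derivative e_coord k (D p d)) (at 0)"
    if "p \<in> \<Omega>" for k p d
    unfolding U_def
    by (rule bounded_linear.has_vector_derivative[OF bounded_linear_e_coord \<Phi>_deriv[OF that]])
  have partial: "partial_deriv (U k) j p = e_coord k (D p (axis j 1))" if "p \<in> \<Omega>" for k j p
    unfolding partial_deriv_def by (rule vector_derivative_at[OF U_deriv[OF that]])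

  have differential: "formal_differential U p d = D p d" if p: "p \<in> \<Omega>" for p d
  proof -
    have "linear (D p)"
      by (rule linearI) (simp_all add: D_def z.add z.scale algebra_simps)
    then have lin: "linear (\<lambda>d. e_coord k (D p d))" for k
      using linear_compose[OF _ bounded_linear.linear[OF bounded_linear_e_coord]]
      by (simp add: o_def)
    have "e_coord k (D p d) = (\<Sum>j\<in>UNIV. d $ j *\<^sub>R e_coord k (D p (axis j 1)))" for k
      using linear_sum[OF lin, of k "\<lambda>j. d $ j *\<^sub>R axis j 1" UNIV]
        basis_expansion[of d]
      by (simp add: scalar_mult_eq_scaleR linear_cmul[OF lin])
    then have "(\<Sum>j\<in>UNIV. partial_deriv (U k) j p * of_real (d $ j)) = e_coord k (D p d)" for k
      by (simp add: partial[OF p] scaleR_conv_of_real mult.commute)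
    then show ?thesis
      by (simp only: formal_differential_def e_coord_expansion)
  qed

  define A where "A s \<zeta> = (if s = 1 then a \<zeta> else 0)" for s :: nat and \<zeta>
  have "(\<Sum>s = 1..16. A s (?z p) * ?z d * b (?z p)) = D p d" for p d
  proof -
    have "(\<Sum>s = 1..16. A s (?z p) * ?z d * b (?z p)) = (\<Sum>s = 1..16::nat. if s = 1 then D p d else 0)"
      by (rule sum.cong) (simp_all add: A_def D_def)
    then show ?thesis by simp
  qed
  then have "\<exists>A B :: nat \<Rightarrow> cquat \<Rightarrow> cquat. \<forall>p\<in>\<Omega>. \<forall>d. formal_differential U p d =
      (\<Sum>s = 1..16. A s (?z p) * ?z d * B s (?z p))"
    by (intro exI[of _ A] exI[of _ "\<lambda>_. b"]) (simp add: differential)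
  moreover have "partial_differentiable (U k) j p" if "p \<in> \<Omega>" for k j p
    unfolding partial_differentiable_def
    by (rule differentiableI_vector[OF U_deriv[OF that]])
  moreover have "\<Phi> (?z p) = (\<Sum>k = 1..4. of_cpx (U k p) * e_basis k)" for p
    by (simp only: U_def e_coord_expansion)
  ultimately show ?thesis
    unfolding H_monogenic_def using cont by (intro conjI exI[of _ U]) simp_all
qed

theorem mainTheorem1:
  fixes a1 a2 b1 b2 :: complex
    and i2 i3 :: cquat
    and \<Omega> :: "(real ^ 3) set"
  assumes i2: "i2 = of_cpx a1 * e1 + of_cpx a2 * e2"
    and i3: "i3 = of_cpx b1 * e1 + of_cpx b2 * e2"
    and indep: "distinct [1, i2, i3]" "independent {1, i2, i3}"
    and domain: "open \<Omega>" "connected \<Omega>" "\<Omega> \<noteq> {}"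
  shows "(\<forall>\<Phi>. right_G_monogenic i2 i3 \<Omega> \<Phi> \<longrightarrow> H_monogenic i2 i3 \<Omega> \<Phi>) \<and>
         (\<forall>\<Phi>. left_G_monogenic i2 i3 \<Omega> \<Phi> \<longrightarrow> H_monogenic i2 i3 \<Omega> \<Phi>)"
proof (intro conjI allI impI)
  fix \<Phi> assume "right_G_monogenic i2 i3 \<Omega> \<Phi>"
  then obtain \<Phi>' where "continuous_on (Omega_zeta i2 i3 \<Omega>) \<Phi>"
    and "\<forall>\<zeta>\<in>Omega_zeta i2 i3 \<Omega>. \<forall>h\<in>E3 i2 i3.
      ((\<lambda>\<epsilon>. (\<Phi> (\<zeta> + \<epsilon> *\<^sub>R h) - \<Phi> \<zeta>) /\<^sub>R \<epsilon>) \<longlongrightarrow> h * \<Phi>' \<zeta>) (at_right 0)"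
    unfolding right_G_monogenic_def bchoice_iff by blast
  then show "H_monogenic i2 i3 \<Omega> \<Phi>"
    by (intro H_monogenic_of_sandwich_derivative[where a = "\<lambda>_. 1" and b = \<Phi>']) simp_all
next
  fix \<Phi> assume "left_G_monogenic i2 i3 \<Omega> \<Phi>"
  then obtain \<Phi>' where "continuous_on (Omega_zeta i2 i3 \<Omega>) \<Phi>"
    and "\<forall>\<zeta>\<in>Omega_zeta i2 i3 \<Omega>. \<forall>h\<in>E3 i2 i3.
      ((\<lambda>\<epsilon>. (\<Phi> (\<zeta> + \<epsilon> *\<^sub>R h) - \<Phi> \<zeta>) /\<^sub>R \<epsilon>) \<longlongrightarrow> \<Phi>' \<zeta> * h) (at_right 0)"
    unfolding left_G_monogenic_def bchoice_iff by blast
  then show "H_monogenic i2 i3 \<Omega> \<Phi>"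
    by (intro H_monogenic_of_sandwich_derivative[where a = \<Phi>' and b = "\<lambda>_. 1"]) simp_all
qed

end
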